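(* There is no stable base $\mathcal{B}$ such that for all valid $\mathcal{B}$-libraries $\rho$ the law $A,\ \neg_\rho A\ \vdash_\rho\ \mathcal{F}$ holds (i.e. is true for every algorithmic statement $A$).
   Context: Framework. Algorithms are recursive algorithms in a fixed standard model. A datum is anything that can be input to an algorithm; data include natural numbers and algorithms, and every finite list of data is a datum. Every algorithm accepts exactly one input datum and either does not halt or halts with exactly one output datum. Every datum has a positive integer size, only finitely many data have a given size, and the size of a list is strictly greater than the sum of the sizes of its items. A process is a pair (algorithm, input). Every halting process has a positive integer runtime; if a process runs subprocesses in its execution, its runtime is strictly greater than the sum of the runtimes of the halting subprocesses. An algorithmic statement is a datum $[\alpha,u,v]$ with $\alpha$ an algorithm, asserting that $\alpha$ with input $u$ halts with output $v$; it is true if this is so and false otherwise. To say that an algorithmic statement holds is to say that it is true. $\mathcal{F}$ denotes the false statement $[\mathrm{identity},0,1]$, where $\mathrm{identity}$ outputs a copy of its input. Rules and libraries. An algorithmic sequence is an algorithm $\rho$ that halts on every positive integer $n$; its output is written $\rho_n$. A rule is an algorithm which, on every input $[H,\rho,m]$ with $H$ a finite list of algorithmic statements (hypothesis list), $\rho$ an algorithmic sequence (nominal library) and $m$ a positive integer (resource integer), halts and outputs a list of algorithmic statements (conclusion list) having $H$ as an initial sublist, and which is monotone: if $m'\ge m$ and every item of $H$ is an item of $H'$, then every item of the output on $[H,\rho,m]$ is an item of the output on $[H',\rho,m']$. A library is an algorithmic sequence $\rho$ such that every $\rho_n$ is a rule (not necessarily distinct); the $\rho_n$ are the rules contained in $\rho$.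 A rule is $\rho$-valid if for every list $H$ of true statements and every $m$, its output on $[H,\rho,m]$ consists only of true statements. A library $\rho$ is valid if all its rules are $\rho$-valid. Bases. A base is a set $\mathcal{B}$ of rules that is finite or is the set of terms of a library. A $\mathcal{B}$-library is a library containing all rules of $\mathcal{B}$. A $\mathcal{B}$-library $\rho$ is valid outside $\mathcal{B}$ if every rule in $\rho$ which is not in $\mathcal{B}$ is $\rho$-valid. A base $\mathcal{B}$ is stable if every $\mathcal{B}$-library that is valid outside $\mathcal{B}$ is valid. Deduction. Fix a recursive bijection $f:\mathbb{N}_+\to\mathbb{N}_+\times\mathbb{N}_+$. The algorithm $\mathrm{deduce}$, on input $[\Gamma,\rho,B]$ ($\Gamma$ a list of algorithmic statements, $\rho$ a library, $B$ an algorithmic statement), computes lists $H_0=\Gamma,H_1,H_2,\dots$, where for $i>0$ with $f(i)=(k,m)$ the list $H_i$ is the output of $\rho_k$ on $[H_{i-1},\rho,m]$; after computing each $H_i$ it checks whether $B$ is on $H_i$, outputs $1$ if so, and otherwise continues. The algorithmic statement $[\mathrm{deduce},[\Gamma,\rho,B],1]$ is denoted $\Gamma\vdash_\rho B$ (the notation is used for any datum $\rho$), and $A_1,\dots,A_n\vdash_\rho B$ means this with $\Gamma=[A_1,\dots,A_n]$. $A\Rightarrow_\rho B$ denotes $A\vdash_\rho B$, and $\neg_\rho A$ denotes $A\Rightarrow_\rho\mathcal{F}$. *)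

theory Defs
  imports "HOL-Library.Sublist" "HOL-Library.Nat_Bijection"
begin

section \<open>The model of computation\<close>

text \<open>
  The fixed standard model is a small variable-free Lisp: data are S-expressions over the natural
  numbers, and algorithms are combinator terms with a big-step semantics.  Algorithms are data via
  an injective quotation \<open>quote\<close> that yields ordinary lists, so programs can build, inspect and
  run the code of other programs.
\<close>

datatype datum = Num nat | Lst "datum list"

datatype alg =
    Identity
  | Constant datum
  | Compose alg alg
  | Successor
  | Push alg alg
  | Head
  | Tail
  | IsList
  | Equal
  | IfElse alg alg alg
  | While alg alg
  | Run

primrec quote :: "alg \<Rightarrow> datum" where
  "quote Identity = Lst [Num 0]"
| "quote (Constant d) = Lst [Num 1, d]"
| "quote (Compose g f) = Lst [Num 2, quote g, quote f]"
| "quote Successor = Lst [Num 3]"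
| "quote (Push f g) = Lst [Num 4, quote f, quote g]"
| "quote Head = Lst [Num 5]"
| "quote Tail = Lst [Num 6]"
| "quote IsList = Lst [Num 7]"
| "quote Equal = Lst [Num 8]"
| "quote (IfElse c f g) = Lst [Num 9, quote c, quote f, quote g]"
| "quote (While c f) = Lst [Num 10, quote c, quote f]"
| "quote Run = Lst [Num 11]"

lemma quote_inject [simp]: "quote a = quote b \<longleftrightarrow> a = b"
proof
  show "quote a = quote b \<Longrightarrow> a = b"
    by (induction a arbitrary: b; case_tac b; simp)
qed simp

text \<open>
  \<open>runs a x y t\<close>: on input \<open>x\<close> the algorithm \<open>a\<close> halts with output \<open>y\<close> and runtime \<open>t\<close>.
  A process to which no rule applies (such as \<open>Head\<close> on the empty list, or \<open>Run\<close> on something that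
  is not a pair of a quoted algorithm and an input) does not halt.  As truth values, \<open>Num 0\<close> is
  false and every other datum is true.
\<close>

inductive runs :: "alg \<Rightarrow> datum \<Rightarrow> datum \<Rightarrow> nat \<Rightarrow> bool" where
  Identity: "runs Identity x x 1"
| Constant: "runs (Constant d) x d 1"
| Compose: "runs f x y s \<Longrightarrow> runs g y z t \<Longrightarrow> runs (Compose g f) x z (s + t + 1)"
| Successor: "runs Successor (Num n) (Num (Suc n)) 1"
| Push: "runs f x y s \<Longrightarrow> runs g x (Lst ys) t \<Longrightarrow> runs (Push f g) x (Lst (y # ys)) (s + t + 1)"
| Head: "runs Head (Lst (x # xs)) x 1"
| Tail: "runs Tail (Lst (x # xs)) (Lst xs) 1"
| IsList_Num: "runs IsList (Num n) (Num 0) 1"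
| IsList_Lst: "runs IsList (Lst xs) (Num 1) 1"
| Equal: "runs Equal (Lst [x, y]) (Num (if x = y then 1 else 0)) 1"
| IfElse_true: "runs c x b s \<Longrightarrow> b \<noteq> Num 0 \<Longrightarrow> runs f x y t \<Longrightarrow> runs (IfElse c f g) x y (s + t + 1)"
| IfElse_false: "runs c x (Num 0) s \<Longrightarrow> runs g x y t \<Longrightarrow> runs (IfElse c f g) x y (s + t + 1)"
| While_stop: "runs c x (Num 0) s \<Longrightarrow> runs (While c f) x x (s + 1)"
| While_loop: "runs c x b s \<Longrightarrow> b \<noteq> Num 0 \<Longrightarrow> runs f x y t \<Longrightarrow> runs (While c f) y z w
    \<Longrightarrow> runs (While c f) x z (s + t + w + 1)"
| Run: "runs a x y t \<Longrightarrow> runs Run (Lst [quote a, x]) y (t + 1)"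

definition halts :: "alg \<Rightarrow> datum \<Rightarrow> datum \<Rightarrow> bool" where
  "halts a x y \<longleftrightarrow> (\<exists>t. runs a x y t)"

inductive_cases runs_IdentityE: "runs Identity x y t"
inductive_cases runs_ConstantE: "runs (Constant d) x y t"
inductive_cases runs_ComposeE: "runs (Compose g f) x y t"
inductive_cases runs_SuccessorE: "runs Successor x y t"
inductive_cases runs_PushE: "runs (Push f g) x y t"
inductive_cases runs_HeadE: "runs Head x y t"
inductive_cases runs_TailE: "runs Tail x y t"
inductive_cases runs_IsListE: "runs IsList x y t"
inductive_cases runs_EqualE: "runs Equal x y t"
inductive_cases runs_IfElseE: "runs (IfElse c f g) x y t"
inductive_cases runs_WhileE: "runs (While c f) x y t"
inductive_cases runs_RunE: "runs Run x y t"

lemmas runs_elims = runs_IdentityE runs_ConstantE runs_ComposeE runs_SuccessorE runs_PushE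
  runs_HeadE runs_TailE runs_IsListE runs_EqualE runs_IfElseE runs_RunE

lemma runs_deterministic:
  assumes "runs a x y t" and "runs a x y' t'"
  shows "y = y' \<and> t = t'"
  using assms
proof (induction arbitrary: y' t' rule: runs.induct)
  case (Compose f x y s g z t)
  from Compose.prems show ?case
    by (auto elim!: runs_ComposeE dest!: Compose.IH)
next
  case (Push f x y s g ys t)
  from Push.prems show ?case
    by (auto elim!: runs_PushE dest!: Push.IH)
next
  case (IfElse_true c x b s f y t g)
  from IfElse_true.prems \<open>b \<noteq> Num 0\<close> show ?case
    by (auto elim!: runs_IfElseE dest!: IfElse_true.IH)
next
  case (IfElse_false c x s g y t f)
  from IfElse_false.prems show ?case
    by (auto elim!: runs_IfElseE dest!: IfElse_false.IH)
next
  case (While_stop c x s f)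
  from While_stop.prems show ?case
    by (rule runs_WhileE) (auto dest!: While_stop.IH)
next
  case (While_loop c x b s f y t z w)
  from While_loop.prems show ?case
  proof (rule runs_WhileE)
    fix s' assume "runs c x (Num 0) s'"
    then show ?thesis using While_loop.IH(1) \<open>b \<noteq> Num 0\<close> by blast
  next
    fix b' s' y'' t'' w'
    assume t': "t' = Suc (s' + t'' + w')"
      and "runs c x b' s'" "runs f x y'' t''" and loop: "runs (While c f) y'' y' w'"
    then have "s = s'" "y = y''" "t = t''" using While_loop.IH(1,2) by blast+
    then show ?thesis using While_loop.IH(3) loop t' by simp
  qed
next
  case (Run a x y t)
  from Run.prems show ?case
    by (rule runs_RunE) (use Run.IH in simp)
qed (auto elim: runs_elims)

lemma halts_deterministic: "halts a x y \<Longrightarrow> halts a x y' \<Longrightarrow> y = y'"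
  unfolding halts_def using runs_deterministic by blast

lemma runtime_pos: "runs a x y t \<Longrightarrow> 0 < t"
  by (induction rule: runs.induct) auto

text \<open>
  The size and the runtime have the properties the framework asks for; deduction and validity do not
  depend on them.
\<close>

primrec dsize :: "datum \<Rightarrow> nat" where
  "dsize (Num n) = n + 1"
| "dsize (Lst xs) = sum_list (map dsize xs) + 1"

lemma dsize_pos: "0 < dsize d"
  by (cases d) auto

lemma finite_dsize: "finite {d. dsize d = n}"
proof -
  have "finite {d. dsize d \<le> n}"
  proof (induction n)
    case 0
    have "{d. dsize d \<le> 0} = {}" using dsize_pos by (auto simp: less_eq_nat.simps)
    then show ?case by (simp only: finite.emptyI)
  next
    case (Suc n)
    let ?S = "{d. dsize d \<le> n}"
    have len: "length xs \<le> sum_list (map dsize xs)" for xs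
    proof (induction xs)
      case (Cons x xs)
      then show ?case using dsize_pos[of x] by simp
    qed simp
    have "{d. dsize d \<le> Suc n} \<subseteq> Num ` {..n} \<union> Lst ` {xs. set xs \<subseteq> ?S \<and> length xs \<le> n}"
    proof
      fix d assume d: "d \<in> {d. dsize d \<le> Suc n}"
      show "d \<in> Num ` {..n} \<union> Lst ` {xs. set xs \<subseteq> ?S \<and> length xs \<le> n}"
      proof (cases d)
        case (Lst xs)
        then have s: "sum_list (map dsize xs) \<le> n" using d by simp
        have "dsize x \<le> n" if "x \<in> set xs" for x
          using member_le_sum_list[of "dsize x" "map dsize xs"] that s by fastforce
        then show ?thesis using Lst s len[of xs] by auto
      qed (use d in auto)
    qed
    then show ?case
      by (rule finite_subset) (use finite_lists_length_le[OF Suc.IH, of n] in simp)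
  qed
  then show ?thesis by (rule rev_finite_subset) auto
qed

lemma halts_Identity [simp]: "halts Identity x y \<longleftrightarrow> y = x"
  unfolding halts_def by (auto elim: runs_IdentityE intro: runs.Identity)

lemma halts_Constant [simp]: "halts (Constant d) x y \<longleftrightarrow> y = d"
  unfolding halts_def by (auto elim: runs_ConstantE intro: runs.Constant)

lemma halts_Compose [simp]: "halts (Compose g f) x z \<longleftrightarrow> (\<exists>y. halts f x y \<and> halts g y z)"
  unfolding halts_def by (blast elim: runs_ComposeE intro: runs.Compose)

lemma halts_Successor [simp]: "halts Successor x y \<longleftrightarrow> (\<exists>n. x = Num n \<and> y = Num (Suc n))"
  unfolding halts_def by (blast elim: runs_SuccessorE intro: runs.Successor)

lemma halts_Push [simp]:
  "halts (Push f g) x z \<longleftrightarrow> (\<exists>y ys. halts f x y \<and> halts g x (Lst ys) \<and> z = Lst (y # ys))"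
  unfolding halts_def by (blast elim: runs_PushE intro: runs.Push)

lemma halts_Head [simp]: "halts Head x y \<longleftrightarrow> (\<exists>xs. x = Lst (y # xs))"
  unfolding halts_def by (blast elim: runs_HeadE intro: runs.Head)

lemma halts_Tail [simp]: "halts Tail x y \<longleftrightarrow> (\<exists>z zs. x = Lst (z # zs) \<and> y = Lst zs)"
  unfolding halts_def by (blast elim: runs_TailE intro: runs.Tail)

lemma halts_IsList [simp]:
  "halts IsList x y \<longleftrightarrow> y = (case x of Num _ \<Rightarrow> Num 0 | Lst _ \<Rightarrow> Num 1)"
  unfolding halts_def
  by (cases x) (auto elim: runs_IsListE intro: runs.IsList_Num runs.IsList_Lst[simplified])

lemma halts_Equal [simp]:
  "halts Equal x y \<longleftrightarrow> (\<exists>u v. x = Lst [u, v] \<and> y = Num (if u = v then 1 else 0))"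
  unfolding halts_def by (blast elim: runs_EqualE intro: runs.Equal)

lemma halts_IfElse [simp]:
  "halts (IfElse c f g) x y \<longleftrightarrow>
    (\<exists>b. halts c x b \<and> (if b = Num 0 then halts g x y else halts f x y))"
  unfolding halts_def
  by (auto elim!: runs_IfElseE intro: runs.IfElse_true runs.IfElse_false split: if_splits)

lemma halts_While:
  "halts (While c f) x z \<longleftrightarrow>
    (\<exists>b. halts c x b \<and>
      (if b = Num 0 then z = x else (\<exists>y. halts f x y \<and> halts (While c f) y z)))"
proof
  assume "halts (While c f) x z"
  then obtain t where "runs (While c f) x z t" unfolding halts_def by blast
  then show "\<exists>b. halts c x b \<and>
      (if b = Num 0 then z = x else (\<exists>y. halts f x y \<and> halts (While c f) y z))"
    unfolding halts_def by (cases rule: runs_WhileE) auto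
next
  assume "\<exists>b. halts c x b \<and>
      (if b = Num 0 then z = x else (\<exists>y. halts f x y \<and> halts (While c f) y z))"
  then show "halts (While c f) x z"
    unfolding halts_def
    by (auto intro: runs.While_stop runs.While_loop split: if_splits)
qed

lemma halts_While_loopI:
  "halts c x b \<Longrightarrow> b \<noteq> Num 0 \<Longrightarrow> halts f x y \<Longrightarrow> halts (While c f) y z \<Longrightarrow> halts (While c f) x z"
  unfolding halts_def by (blast intro: runs.While_loop)

lemma halts_Run [simp]: "halts Run p y \<longleftrightarrow> (\<exists>a x. p = Lst [quote a, x] \<and> halts a x y)"
  unfolding halts_def by (blast elim: runs_RunE intro: runs.Run)


section \<open>Algorithmic statements, rules and libraries\<close>

definition statement :: "datum \<Rightarrow> bool" where
  "statement A \<longleftrightarrow> (\<exists>a u v. A = Lst [quote a, u, v])"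

definition true_statement :: "datum \<Rightarrow> bool" where
  "true_statement A \<longleftrightarrow> (\<exists>a u v. A = Lst [quote a, u, v] \<and> halts a u v)"

definition false_statement :: datum ("\<F>") where
  "\<F> = Lst [quote Identity, Num 0, Num 1]"

definition algorithmic_sequence :: "alg \<Rightarrow> bool" where
  "algorithmic_sequence \<rho> \<longleftrightarrow> (\<forall>n\<ge>1. \<exists>d. halts \<rho> (Num n) d)"

abbreviation rule_input :: "datum list \<Rightarrow> alg \<Rightarrow> nat \<Rightarrow> datum" where
  "rule_input H \<rho> m \<equiv> Lst [Lst H, quote \<rho>, Num m]"

definition rule :: "alg \<Rightarrow> bool" where
  "rule r \<longleftrightarrow>
    (\<forall>H \<rho> m. list_all statement H \<and> algorithmic_sequence \<rho> \<and> m \<ge> 1 \<longrightarrow>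
      (\<exists>C. halts r (rule_input H \<rho> m) (Lst C) \<and> list_all statement C \<and> prefix H C)) \<and>
    (\<forall>H H' \<rho> m m' C C'.
      list_all statement H \<and> list_all statement H' \<and> algorithmic_sequence \<rho> \<and>
      m \<ge> 1 \<and> m' \<ge> m \<and> set H \<subseteq> set H' \<and>
      halts r (rule_input H \<rho> m) (Lst C) \<and> halts r (rule_input H' \<rho> m') (Lst C') \<longrightarrow>
      set C \<subseteq> set C')"

definition library :: "alg \<Rightarrow> bool" where
  "library \<rho> \<longleftrightarrow> (\<forall>n\<ge>1. \<exists>r. halts \<rho> (Num n) (quote r) \<and> rule r)"

definition rules_of :: "alg \<Rightarrow> alg set" where
  "rules_of \<rho> = {r. \<exists>n\<ge>1. halts \<rho> (Num n) (quote r)}"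

definition rule_valid :: "alg \<Rightarrow> alg \<Rightarrow> bool" where
  "rule_valid \<rho> r \<longleftrightarrow>
    (\<forall>H m C. list_all true_statement H \<and> m \<ge> 1 \<and> halts r (rule_input H \<rho> m) (Lst C) \<longrightarrow>
      list_all true_statement C)"

definition valid_library :: "alg \<Rightarrow> bool" where
  "valid_library \<rho> \<longleftrightarrow> library \<rho> \<and> (\<forall>r\<in>rules_of \<rho>. rule_valid \<rho> r)"


section \<open>Bases\<close>

definition base :: "alg set \<Rightarrow> bool" where
  "base B \<longleftrightarrow> (\<forall>r\<in>B. rule r) \<and> (finite B \<or> (\<exists>\<beta>. library \<beta> \<and> B = rules_of \<beta>))"

definition base_library :: "alg set \<Rightarrow> alg \<Rightarrow> bool" where
  "base_library B \<rho> \<longleftrightarrow> library \<rho> \<and> B \<subseteq> rules_of \<rho>"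

definition valid_outside :: "alg set \<Rightarrow> alg \<Rightarrow> bool" where
  "valid_outside B \<rho> \<longleftrightarrow> (\<forall>r\<in>rules_of \<rho> - B. rule_valid \<rho> r)"

definition stable_base :: "alg set \<Rightarrow> bool" where
  "stable_base B \<longleftrightarrow> (\<forall>\<rho>. base_library B \<rho> \<and> valid_outside B \<rho> \<longrightarrow> valid_library \<rho>)"


section \<open>Deduction\<close>

primrec tuple :: "alg list \<Rightarrow> alg" where
  "tuple [] = Constant (Lst [])"
| "tuple (f # fs) = Push f (tuple fs)"

primrec item :: "nat \<Rightarrow> alg" where
  "item 0 = Head"
| "item (Suc n) = Compose (item n) Tail"

definition call :: "alg \<Rightarrow> alg \<Rightarrow> alg" where
  "call f g = Compose Run (tuple [f, g])"

text \<open>On input \<open>[x, xs]\<close>, output \<open>0\<close> if \<open>x\<close> is on the list \<open>xs\<close> and \<open>1\<close> otherwise.\<close>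

definition nonmember :: alg where
  "nonmember =
    (let nil = Compose Equal (tuple [item 1, Constant (Lst [])]);
         found = Compose Equal (tuple [item 0, Compose Head (item 1)])
     in Compose nil
          (While
            (IfElse nil (Constant (Num 0)) (IfElse found (Constant (Num 0)) (Constant (Num 1))))
            (tuple [item 0, Compose Tail (item 1)])))"

text \<open>
  The parameter \<open>\<phi>\<close> is an algorithm computing the fixed bijection \<open>f\<close>, with \<open>f i = (k, m)\<close> output
  as the list \<open>[k, m]\<close>.  The loop works on states \<open>[H, i, \<rho>, B]\<close>, where \<open>H\<close> is the
  current list and \<open>i\<close> is the index of the next one.  The first step precedes the first test, since
  the initial list is not searched for \<open>B\<close>.
\<close>

definition deduce_step :: "alg \<Rightarrow> alg" where
  "deduce_step \<phi> =
    (let pair = Compose \<phi> (item 1); k = Compose (item 0) pair; m = Compose (item 1) pair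
     in tuple [call (call (item 2) k) (tuple [item 0, item 2, m]),
               Compose Successor (item 1), item 2, item 3])"

definition deduce :: "alg \<Rightarrow> alg" where
  "deduce \<phi> =
    Compose (Constant (Num 1))
      (Compose (While (Compose nonmember (tuple [item 3, item 0])) (deduce_step \<phi>))
        (Compose (deduce_step \<phi>)
          (tuple [item 0, Constant (Num 1), item 1, item 2])))"

definition computes_bijection :: "alg \<Rightarrow> (nat \<Rightarrow> nat \<times> nat) \<Rightarrow> bool" where
  "computes_bijection \<phi> f \<longleftrightarrow>
    bij_betw f {1..} ({1..} \<times> {1..}) \<and>
    (\<forall>i\<ge>1. halts \<phi> (Num i) (Lst [Num (fst (f i)), Num (snd (f i))]))"

definition deducible :: "alg \<Rightarrow> datum list \<Rightarrow> datum \<Rightarrow> datum \<Rightarrow> datum" where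
  "deducible \<phi> \<Gamma> \<rho> B = Lst [quote (deduce \<phi>), Lst [Lst \<Gamma>, \<rho>, B], Num 1]"

definition implication :: "alg \<Rightarrow> datum \<Rightarrow> datum \<Rightarrow> datum \<Rightarrow> datum" where
  "implication \<phi> A \<rho> B = deducible \<phi> [A] \<rho> B"

definition negation :: "alg \<Rightarrow> datum \<Rightarrow> datum \<Rightarrow> datum" where
  "negation \<phi> \<rho> A = implication \<phi> A \<rho> \<F>"

text \<open>The program \<open>deduce\<close> meets its specification.\<close>

lemma halts_item:
  "halts (item n) (Lst xs) y \<longleftrightarrow> n < length xs \<and> y = xs ! n"
proof (induction n arbitrary: xs)
  case 0
  then show ?case by (cases xs) auto
next
  case (Suc n)
  then show ?case by (cases xs) auto
qed

lemma halts_call [simp]: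
  "halts (call f g) x y \<longleftrightarrow> (\<exists>a u. halts f x (quote a) \<and> halts g x u \<and> halts a u y)"
  unfolding call_def by auto

lemma halts_nonmember:
  "halts nonmember (Lst [x, Lst xs]) y \<longleftrightarrow> y = Num (if x \<in> set xs then 0 else 1)"
proof -
  have "halts nonmember (Lst [x, Lst xs]) (Num (if x \<in> set xs then 0 else 1))"
  proof (induction xs)
    case Nil
    then show ?case unfolding nonmember_def Let_def
      by (simp add: halts_item halts_While del: item.simps)
  next
    case (Cons z zs)
    then show ?case unfolding nonmember_def Let_def
      by (subst halts_Compose, subst halts_While) (auto simp: halts_item simp del: item.simps)
  qed
  then show ?thesis using halts_deterministic by blast
qed

text \<open>
  \<open>H 0\<close>, \<open>H 1\<close>, ... are the lists computed by \<open>deduce\<close>; only \<open>f i\<close> with \<open>i \<ge> 1\<close> matters.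
\<close>

definition deduction :: "(nat \<Rightarrow> nat \<times> nat) \<Rightarrow> alg \<Rightarrow> (nat \<Rightarrow> datum list) \<Rightarrow> bool" where
  "deduction f \<rho> H \<longleftrightarrow>
    (\<forall>i\<ge>1. \<exists>r. halts \<rho> (Num (fst (f i))) (quote r) \<and>
      halts r (rule_input (H (i - 1)) \<rho> (snd (f i))) (Lst (H i)))"

lemma rule_halts:
  "rule r \<Longrightarrow> list_all statement H \<Longrightarrow> algorithmic_sequence \<rho> \<Longrightarrow> m \<ge> 1 \<Longrightarrow>
    \<exists>C. halts r (rule_input H \<rho> m) (Lst C) \<and> list_all statement C \<and> prefix H C"
  unfolding rule_def by blast

lemma deduction_exists:
  assumes \<phi>: "computes_bijection \<phi> f" and lib: "library \<rho>" and \<Gamma>: "list_all statement \<Gamma>"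
  shows "\<exists>H. H 0 = \<Gamma> \<and> deduction f \<rho> H"
proof -
  have seq: "algorithmic_sequence \<rho>"
    using lib unfolding library_def algorithmic_sequence_def by blast
  have pos: "fst (f i) \<ge> 1 \<and> snd (f i) \<ge> 1" if "i \<ge> 1" for i
    using \<phi> that bij_betwE[of f "{1..}" "{1..} \<times> {1..}"]
    unfolding computes_bijection_def by (auto simp: mem_Times_iff)
  have step: "\<exists>C. list_all statement C \<and> (\<exists>r. halts \<rho> (Num (fst (f (Suc i)))) (quote r) \<and>
      halts r (rule_input H \<rho> (snd (f (Suc i)))) (Lst C))" if stH: "list_all statement H" for H i
  proof -
    obtain r where r: "halts \<rho> (Num (fst (f (Suc i)))) (quote r)" "rule r"
      using lib pos[of "Suc i"] unfolding library_def by auto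
    obtain C where "halts r (rule_input H \<rho> (snd (f (Suc i)))) (Lst C)" "list_all statement C"
      using rule_halts[OF r(2) stH seq, of "snd (f (Suc i))"] pos[of "Suc i"] by auto
    then show ?thesis using r(1) by blast
  qed
  define nxt where "nxt i H = (SOME C. list_all statement C \<and>
      (\<exists>r. halts \<rho> (Num (fst (f (Suc i)))) (quote r) \<and>
        halts r (rule_input H \<rho> (snd (f (Suc i)))) (Lst C)))" for i H
  have nxt: "list_all statement (nxt i H)"
    "\<exists>r. halts \<rho> (Num (fst (f (Suc i)))) (quote r) \<and>
      halts r (rule_input H \<rho> (snd (f (Suc i)))) (Lst (nxt i H))" if "list_all statement H" for i H
    using someI_ex[OF step[OF that, of i]] unfolding nxt_def by simp_all
  define H where "H = rec_nat \<Gamma> nxt"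
  have stm: "list_all statement (H i)" for i
    by (induction i) (simp_all add: H_def \<Gamma> nxt(1))
  have "deduction f \<rho> H"
    unfolding deduction_def
  proof (intro allI impI)
    fix i :: nat assume "i \<ge> 1"
    then show "\<exists>r. halts \<rho> (Num (fst (f i))) (quote r) \<and>
        halts r (rule_input (H (i - 1)) \<rho> (snd (f i))) (Lst (H i))"
      using nxt(2)[OF stm, of "i - 1"] by (cases i) (auto simp: H_def)
  qed
  moreover have "H 0 = \<Gamma>" by (simp add: H_def)
  ultimately show ?thesis by blast
qed

lemma halts_deduce_step:
  assumes \<phi>: "computes_bijection \<phi> f" and H: "deduction f \<rho> H"
  shows "halts (deduce_step \<phi>) (Lst [Lst (H i), Num (Suc i), quote \<rho>, B]) y \<longleftrightarrow>
    y = Lst [Lst (H (Suc i)), Num (Suc (Suc i)), quote \<rho>, B]"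
proof -
  have f: "halts \<phi> (Num (Suc i)) (Lst [Num (fst (f (Suc i))), Num (snd (f (Suc i)))])"
    using \<phi> unfolding computes_bijection_def by simp
  have f': "halts \<phi> (Num (Suc i)) z \<longleftrightarrow> z = Lst [Num (fst (f (Suc i))), Num (snd (f (Suc i)))]"
    for z using f halts_deterministic by blast
  obtain r where r: "halts \<rho> (Num (fst (f (Suc i)))) (quote r)"
    "halts r (rule_input (H i) \<rho> (snd (f (Suc i)))) (Lst (H (Suc i)))"
    using H unfolding deduction_def by (metis diff_Suc_1 le_add1 plus_1_eq_Suc)
  have r': "halts \<rho> (Num (fst (f (Suc i)))) z \<longleftrightarrow> z = quote r" for z
    using r(1) halts_deterministic by blast
  have r'': "halts r (rule_input (H i) \<rho> (snd (f (Suc i)))) z \<longleftrightarrow> z = Lst (H (Suc i))" for z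
    using r(2) halts_deterministic by blast
  show ?thesis
    unfolding deduce_step_def Let_def
    by (auto simp: halts_item f' r' r'' simp del: item.simps)
qed

lemma true_deducible_iff:
  assumes \<phi>: "computes_bijection \<phi> f" and H: "deduction f \<rho> H" "H 0 = \<Gamma>"
  shows "true_statement (deducible \<phi> \<Gamma> (quote \<rho>) B) \<longleftrightarrow> (\<exists>i\<ge>1. B \<in> set (H i))"
proof -
  define state where "state i = Lst [Lst (H i), Num (Suc i), quote \<rho>, B]" for i
  define cond where "cond = Compose nonmember (tuple [item 3, item 0])"
  let ?loop = "While cond (deduce_step \<phi>)"
  have step: "halts (deduce_step \<phi>) (state i) y \<longleftrightarrow> y = state (Suc i)" for i y
    unfolding state_def by (rule halts_deduce_step[OF \<phi> H(1)])
  have cond: "halts cond (state i) y \<longleftrightarrow> y = Num (if B \<in> set (H i) then 0 else 1)" for i y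
    unfolding state_def cond_def
    by (auto simp: halts_item halts_nonmember simp del: item.simps)
  have loopI: "\<exists>y. halts ?loop (state i) y" if "B \<in> set (H (i + d))" for i d
    using that
  proof (induction d arbitrary: i)
    case 0
    then show ?case by (subst halts_While) (simp add: cond)
  next
    case (Suc d)
    then show ?case using Suc.IH[of "Suc i"] by (subst halts_While) (simp add: cond step)
  qed
  have loopE: "\<exists>j\<ge>i. B \<in> set (H j)" if "runs ?loop (state i) y t" for i y t
    using that
  proof (induction t arbitrary: i rule: less_induct)
    case (less t)
    from less.prems consider (stop) "halts cond (state i) (Num 0)"
      | (loop) y' w where "halts (deduce_step \<phi>) (state i) y'" "runs ?loop y' y w" "w < t"
    proof (rule runs_WhileE)
      fix s assume "runs cond (state i) (Num 0) s"
      then show thesis using that(1) halts_def by blast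
    next
      fix s y' t' w
      assume "t = Suc (s + t' + w)" "runs (deduce_step \<phi>) (state i) y' t'" "runs ?loop y' y w"
      then show thesis using that(2)[of y' w] halts_def by auto
    qed
    then show ?case
    proof cases
      case stop
      then show ?thesis using cond by (auto split: if_splits)
    next
      case loop
      then have "runs ?loop (state (Suc i)) y w" using step by simp
      from less.IH[OF loop(3) this] show ?thesis using Suc_leD by blast
    qed
  qed
  have "true_statement (deducible \<phi> \<Gamma> (quote \<rho>) B) \<longleftrightarrow>
      halts (deduce \<phi>) (Lst [Lst \<Gamma>, quote \<rho>, B]) (Num 1)"
    unfolding true_statement_def deducible_def by auto
  also have "\<dots> \<longleftrightarrow> (\<exists>y. halts ?loop (state 1) y)"
    unfolding deduce_def cond_def[symmetric]
    using step[of 0] H(2) by (auto simp: halts_item state_def simp del: item.simps)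
  also have "\<dots> \<longleftrightarrow> (\<exists>i\<ge>1. B \<in> set (H i))"
  proof
    assume "\<exists>i\<ge>1. B \<in> set (H i)"
    then obtain i where "i \<ge> 1" "B \<in> set (H i)" by blast
    then show "\<exists>y. halts ?loop (state 1) y" using loopI[of 1 "i - 1"] by simp
  qed (use loopE halts_def in blast)
  finally show ?thesis .
qed

text \<open>A bijection as required for \<open>deduce\<close> is computable: enumerate the diagonals.\<close>

lemma computes_bijection_exists: "\<exists>\<phi> f. computes_bijection \<phi> f"
proof -
  define neq where "neq a b = IfElse (Compose Equal (tuple [a, b])) (Constant (Num 0)) (Constant (Num 1))"
    for a b
  have neq: "halts (neq a b) x y \<longleftrightarrow> (\<exists>u v. halts a x u \<and> halts b x v \<and> y = Num (if u = v then 0 else 1))"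
    for a b x y
  proof -
    have eq: "halts (Compose Equal (tuple [a, b])) x y \<longleftrightarrow>
        (\<exists>u v. halts a x u \<and> halts b x v \<and> y = Num (if u = v then 1 else 0))" for y
      by (simp del: One_nat_def) blast
    show ?thesis
      unfolding neq_def halts_IfElse eq by (auto split: if_splits)
  qed
  define pred_loop where
    "pred_loop = While (neq (item 0) (Compose Successor (item 1))) (tuple [item 0, Compose Successor (item 1)])"
  define pred where "pred = Compose (item 1) (Compose pred_loop (tuple [Identity, Constant (Num 0)]))"
  have pred_loop: "halts pred_loop (Lst [Num (Suc (j + d)), Num j]) (Lst [Num (Suc (j + d)), Num (j + d)])"
    for j d
  proof (induction d arbitrary: j)
    case 0
    show ?case unfolding pred_loop_def
      by (subst halts_While) (simp add: neq halts_item del: item.simps)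
  next
    case (Suc d)
    have "halts (neq (item 0) (Compose Successor (item 1))) (Lst [Num (Suc (j + Suc d)), Num j]) (Num 1)"
      by (simp add: neq halts_item del: item.simps)
    moreover have "halts (tuple [item 0, Compose Successor (item 1)]) (Lst [Num (Suc (j + Suc d)), Num j])
        (Lst [Num (Suc (j + Suc d)), Num (Suc j)])"
      by (simp add: halts_item del: item.simps)
    moreover have "halts pred_loop (Lst [Num (Suc (j + Suc d)), Num (Suc j)])
        (Lst [Num (Suc (j + Suc d)), Num (j + Suc d)])"
      using Suc.IH[of "Suc j"] by simp
    moreover have "Num 1 \<noteq> Num 0" by simp
    ultimately show ?case
      unfolding pred_loop_def by (metis halts_While_loopI)
  qed
  have pred: "halts pred (Num (Suc n)) y \<longleftrightarrow> y = Num n" for n y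
  proof -
    have "halts pred (Num (Suc n)) (Num n)"
      unfolding pred_def using pred_loop[of 0 n] by (auto simp: halts_item simp del: item.simps)
    then show ?thesis using halts_deterministic by blast
  qed
  define g where "g n = (case prod_decode n of (a, b) \<Rightarrow> (Suc b, Suc a))" for n
  define f where "f i = g (i - 1)" for i
  have g0: "g 0 = (1, 1)"
    by (simp add: g_def prod_decode_def prod_decode_aux.simps)
  have gSuc: "g (Suc n) = (if fst (g n) = 1 then (Suc (snd (g n)), 1)
    else (fst (g n) - 1, Suc (snd (g n))))" for n
  proof -
    obtain a b where ab: "prod_decode n = (a, b)" by fastforce
    then have n: "n = prod_encode (a, b)" by (metis prod_decode_inverse)
    have "prod_decode (Suc n) = (case b of 0 \<Rightarrow> (0, Suc a) | Suc b' \<Rightarrow> (Suc a, b'))"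
    proof -
      have "Suc n = prod_encode (case b of 0 \<Rightarrow> (0, Suc a) | Suc b' \<Rightarrow> (Suc a, b'))"
        unfolding n by (cases b) (auto simp: prod_encode_def)
      then show ?thesis by (metis prod_encode_inverse)
    qed
    then show ?thesis using ab unfolding g_def by (cases b) auto
  qed
  have "bij_betw (\<lambda>(a, b). (Suc b, Suc a)) UNIV ({1..} \<times> {1..} :: (nat \<times> nat) set)"
    by (rule bij_betw_byWitness[where f' = "\<lambda>(k, m). (m - 1, k - 1)"]) auto
  then have "bij_betw g UNIV ({1..} \<times> {1..})"
    using bij_betw_trans[OF bij_prod_decode] by (simp add: g_def[abs_def] comp_def)
  moreover have "bij_betw (\<lambda>i. i - 1) {1..} (UNIV :: nat set)"
    by (rule bij_betw_byWitness[where f' = Suc]) auto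
  ultimately have "bij_betw (g \<circ> (\<lambda>i. i - 1)) {1..} ({1..} \<times> {1..})"
    by (rule bij_betw_trans[rotated])
  then have bij: "bij_betw f {1..} ({1..} \<times> {1..})"
    by (simp add: f_def[abs_def] comp_def)
  define step where
    "step = IfElse (neq (item 2) (Constant (Num 1)))
      (tuple [item 0, Compose Successor (item 1), Compose pred (item 2), Compose Successor (item 3)])
      (tuple [item 0, Compose Successor (item 1), Compose Successor (item 3), Constant (Num 1)])"
  define state where "state i n = Lst [Num i, Num (Suc n), Num (fst (g n)), Num (snd (g n))]" for i n
  have g_pos: "\<exists>k. fst (g n) = Suc k" for n
    by (simp add: g_def split: prod.splits)
  have step: "halts step (state i n) (state i (Suc n))" for i n
  proof -
    obtain k where "fst (g n) = Suc k" using g_pos by blast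
    then show ?thesis
      unfolding step_def state_def by (auto simp: gSuc neq pred halts_item simp del: item.simps)
  qed
  define loop where "loop = While (neq (item 0) (item 1)) step"
  have loop: "halts loop (state (Suc (n + d)) n) (state (Suc (n + d)) (n + d))" for n d
  proof (induction d arbitrary: n)
    case 0
    show ?case unfolding loop_def
      by (subst halts_While) (simp add: neq halts_item state_def del: item.simps)
  next
    case (Suc d)
    have "halts (neq (item 0) (item 1)) (state (Suc (n + Suc d)) n) (Num 1)"
      by (simp add: neq halts_item state_def del: item.simps)
    moreover have "halts loop (state (Suc (n + Suc d)) (Suc n)) (state (Suc (n + Suc d)) (n + Suc d))"
      using Suc.IH[of "Suc n"] by simp
    moreover have "Num 1 \<noteq> Num 0" by simp
    ultimately show ?case
      using step[of "Suc (n + Suc d)" n]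
      unfolding loop_def by (metis halts_While_loopI)
  qed
  define \<phi> where "\<phi> = Compose (tuple [item 2, item 3])
    (Compose loop (tuple [Identity, Constant (Num 1), Constant (Num 1), Constant (Num 1)]))"
  have "halts \<phi> (Num i) (Lst [Num (fst (f i)), Num (snd (f i))])" if "i \<ge> 1" for i
  proof -
    have "halts loop (Lst [Num i, Num 1, Num 1, Num 1]) (state i (i - 1))"
      using loop[of 0 "i - 1"] that by (simp add: state_def g0)
    then show ?thesis
      unfolding \<phi>_def by (auto simp: state_def f_def halts_item simp del: item.simps)
  qed
  with bij have "computes_bijection \<phi> f"
    unfolding computes_bijection_def by blast
  then show ?thesis by blast
qed

end

theory Submission
  imports Defs
begin

text \<open>
  This is Curry's paradox.  For a library \<open>\<rho>\<close> there is a self-referential statement \<open>K\<close> that is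
  true iff \<open>K \<Rightarrow>\<^sub>\<rho> \<F>\<close> is true.  The rule that passes from \<open>K\<close> to \<open>\<not>\<^sub>\<rho> K\<close> receives \<open>\<rho>\<close> as part of its
  input, so it is one fixed rule, and it is \<open>\<rho>\<close>-valid for every \<open>\<rho>\<close>.  Adding it to a stable base
  thus gives a valid library \<open>\<rho>\<close>.  If \<open>K, \<not>\<^sub>\<rho> K \<turnstile>\<^sub>\<rho> \<F>\<close> held there, then already \<open>K \<turnstile>\<^sub>\<rho> \<F>\<close>, that is,
  \<open>K\<close> would be true, and the valid library would deduce \<open>\<F>\<close> from it.
\<close>

section \<open>Programs that reverse a list and append an item\<close>

definition rev_append :: alg where
  "rev_append = Compose (item 1)
    (While
      (IfElse (Compose Equal (tuple [item 0, Constant (Lst [])]))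
        (Constant (Num 0)) (Constant (Num 1)))
      (tuple [Compose Tail (item 0), Push (Compose Head (item 0)) (item 1)]))"

lemma halts_rev_append:
  "halts rev_append (Lst [Lst xs, Lst ys]) y \<longleftrightarrow> y = Lst (rev xs @ ys)"
proof -
  have "halts rev_append (Lst [Lst xs, Lst ys]) (Lst (rev xs @ ys))"
  proof (induction xs arbitrary: ys)
    case Nil
    show ?case unfolding rev_append_def
      by (simp add: halts_item halts_While del: item.simps)
  next
    case (Cons x xs)
    then show ?case unfolding rev_append_def
      by (subst halts_Compose, subst halts_While) (auto simp: halts_item simp del: item.simps)
  qed
  then show ?thesis using halts_deterministic by blast
qed

text \<open>\<open>Push\<close> adds only at the front, but a rule must keep its hypothesis list as
  an initial sublist; hence the list is reversed and reversed back onto the one-item list.\<close>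

definition snoc :: alg where
  "snoc = Compose rev_append
    (tuple [Compose rev_append (tuple [item 0, Constant (Lst [])]), tuple [item 1]])"

lemma halts_snoc: "halts snoc (Lst [Lst xs, x]) y \<longleftrightarrow> y = Lst (xs @ [x])"
  unfolding snoc_def by (auto simp: halts_item halts_rev_append simp del: item.simps)

section \<open>The self-referential statement and its rule\<close>

text \<open>
  The input is \<open>[d, \<rho>]\<close>; the self-reference arises by taking for \<open>d\<close> the code of this very algorithm.
\<close>

definition curry_alg :: "alg \<Rightarrow> alg" where
  "curry_alg \<phi> = Compose (deduce \<phi>)
    (tuple [tuple [tuple [item 0, Identity, Constant (Num 1)]], item 1, Constant \<F>])"

definition curry_statement :: "alg \<Rightarrow> datum \<Rightarrow> datum" where
  "curry_statement \<phi> \<rho> = Lst [quote (curry_alg \<phi>), Lst [quote (curry_alg \<phi>), \<rho>], Num 1]"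

lemma statement_curry_statement: "statement (curry_statement \<phi> \<rho>)"
  unfolding statement_def curry_statement_def by blast

lemma statement_negation: "statement (negation \<phi> \<rho> A)"
  unfolding statement_def negation_def implication_def deducible_def by blast

text \<open>When \<open>d\<close> is the code of \<open>curry_alg \<phi>\<close>, the list that this
  algorithm builds as hypothesis is the Curry statement itself, so it runs
  \<open>deduce \<phi>\<close> on exactly the input that occurs in the negation.\<close>

lemma true_curry_statement_iff:
  "true_statement (curry_statement \<phi> \<rho>) \<longleftrightarrow> true_statement (negation \<phi> \<rho> (curry_statement \<phi> \<rho>))"
proof -
  have "halts (curry_alg \<phi>) (Lst [d, \<rho>]) y \<longleftrightarrow>
      halts (deduce \<phi>) (Lst [Lst [Lst [d, Lst [d, \<rho>], Num 1]], \<rho>, \<F>]) y" for d y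
    unfolding curry_alg_def by (simp add: halts_item del: item.simps)
  then show ?thesis
    by (auto simp: true_statement_def curry_statement_def negation_def implication_def
      deducible_def)
qed

definition curry_rule :: "alg \<Rightarrow> alg" where
  "curry_rule \<phi> =
    (let K = tuple [Constant (quote (curry_alg \<phi>)),
           tuple [Constant (quote (curry_alg \<phi>)), item 1], Constant (Num 1)];
         negK = tuple [Constant (quote (deduce \<phi>)),
           tuple [tuple [K], item 1, Constant \<F>], Constant (Num 1)]
     in IfElse (Compose nonmember (tuple [K, item 0])) (item 0)
          (Compose snoc (tuple [item 0, negK])))"

lemma halts_curry_rule:
  "halts (curry_rule \<phi>) (rule_input H \<rho> m) y \<longleftrightarrow>
    y = Lst (if curry_statement \<phi> (quote \<rho>) \<in> set H
      then H @ [negation \<phi> (quote \<rho>) (curry_statement \<phi> (quote \<rho>))] else H)"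
  unfolding curry_rule_def Let_def
  by (auto simp: halts_item halts_nonmember halts_snoc curry_statement_def negation_def
    implication_def deducible_def simp del: item.simps)

text \<open>Monotone because the added item depends only on \<rho>, and its trigger only on whether
  the Curry statement is an item of the list.\<close>

lemma rule_curry_rule: "rule (curry_rule \<phi>)"
  unfolding rule_def halts_curry_rule by (auto simp: statement_negation)

lemma rule_valid_curry_rule: "rule_valid \<rho> (curry_rule \<phi>)"
  unfolding rule_valid_def halts_curry_rule
  using true_curry_statement_iff by (auto simp: list_all_iff)

section \<open>Libraries containing a base and one more rule\<close>

text \<open>The given bijection \<open>f\<close> serves to interleave \<open>r\<close> with the rules of \<open>\<beta>\<close>.\<close>

lemma library_insert:
  assumes \<phi>: "computes_bijection \<phi> f" and \<beta>: "library \<beta>" and r: "rule r"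
  shows "\<exists>\<rho>. library \<rho> \<and> rules_of \<rho> = insert r (rules_of \<beta>)"
proof -
  \<comment> \<open>If \<open>f n = (k, m)\<close>, the n-th rule is \<open>r\<close> for
    \<open>m = 1\<close> and the k-th rule of \<beta> otherwise.\<close>
  define \<rho> where "\<rho> = Compose
    (IfElse (Compose Equal (tuple [item 1, Constant (Num 1)])) (Constant (quote r))
      (Compose \<beta> (item 0))) \<phi>"
  have \<rho>: "halts \<rho> (Num n) y \<longleftrightarrow> (if snd (f n) = 1 then y = quote r else halts \<beta> (Num (fst (f n))) y)"
    if "n \<ge> 1" for n y
  proof -
    have "halts \<phi> (Num n) z \<longleftrightarrow> z = Lst [Num (fst (f n)), Num (snd (f n))]" for z
      using \<phi> that halts_deterministic unfolding computes_bijection_def by blast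
    then show ?thesis
      unfolding \<rho>_def by (auto simp: halts_item simp del: item.simps)
  qed
  have bij: "bij_betw f {1..} ({1..} \<times> {1..})"
    using \<phi> unfolding computes_bijection_def by blast
  have fst_f: "fst (f n) \<ge> 1" if "n \<ge> 1" for n
    using bij_betwE[OF bij] that by (auto simp: mem_Times_iff)
  have onto: "\<exists>n\<ge>1. f n = (k, m)" if "k \<ge> 1" "m \<ge> 1" for k m
  proof -
    have "(k, m) \<in> f ` {1..}" using bij_betw_imp_surj_on[OF bij] that by simp
    then show ?thesis by force
  qed
  have "library \<rho>"
    unfolding library_def
  proof (intro allI impI)
    fix n :: nat
    assume n: "n \<ge> 1"
    then obtain s where "halts \<beta> (Num (fst (f n))) (quote s)" "rule s"
      using \<beta> fst_f unfolding library_def by blast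
    then show "\<exists>r. halts \<rho> (Num n) (quote r) \<and> rule r"
      using \<rho>[OF n] r by (cases "snd (f n) = 1") auto
  qed
  moreover have "rules_of \<rho> = insert r (rules_of \<beta>)"
  proof
    show "rules_of \<rho> \<subseteq> insert r (rules_of \<beta>)"
      unfolding rules_of_def using \<rho> fst_f by (fastforce split: if_splits)
    have "r \<in> rules_of \<rho>"
      unfolding rules_of_def using \<rho> onto[of 1 1] by force
    moreover have "s \<in> rules_of \<rho>" if "k \<ge> 1" "halts \<beta> (Num k) (quote s)" for s k
      unfolding rules_of_def using \<rho> onto[of k 2] that by force
    ultimately show "insert r (rules_of \<beta>) \<subseteq> rules_of \<rho>"
      by (auto simp: rules_of_def[of \<beta>])
  qed
  ultimately show ?thesis by blast
qed

text \<open>No library has an empty set of rules, so for finite \<open>B\<close> the construction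
  starts from the constant library of \<open>r\<close> and inserts the rules of \<open>B\<close> one
  by one.\<close>

lemma library_insert_base:
  assumes \<phi>: "computes_bijection \<phi> f" and B: "base B" and r: "rule r"
  shows "\<exists>\<rho>. library \<rho> \<and> rules_of \<rho> = insert r B"
proof (cases "finite B")
  case True
  moreover have "\<forall>s\<in>B. rule s" using B unfolding base_def by blast
  ultimately show ?thesis
  proof (induction B)
    case empty
    have "library (Constant (quote r))" "rules_of (Constant (quote r)) = {r}"
      using r by (auto simp: library_def rules_of_def)
    then show ?case by blast
  next
    case (insert s B)
    then obtain \<beta> where "library \<beta>" "rules_of \<beta> = insert r B" by auto
    then show ?case
      using library_insert[OF \<phi>, of \<beta> s] insert.prems by (auto simp: insert_commute)
  qed
next
  case False
  then obtain \<beta> where "library \<beta>" "B = rules_of \<beta>" using B unfolding base_def by blast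
  then show ?thesis using library_insert[OF \<phi> _ r] by simp
qed

section \<open>Monotonicity and soundness of deduction\<close>

context
  fixes \<phi> f \<rho>
  assumes \<phi>: "computes_bijection \<phi> f" and lib: "library \<rho>"
begin

lemma deduction_step:
  assumes H: "deduction f \<rho> H" and n: "n \<ge> 1"
  obtains r where "rule r" "r \<in> rules_of \<rho>" "halts \<rho> (Num (fst (f n))) (quote r)"
    "halts r (rule_input (H (n - 1)) \<rho> (snd (f n))) (Lst (H n))"
    "fst (f n) \<ge> 1" "snd (f n) \<ge> 1"
proof -
  have pos: "fst (f n) \<ge> 1" "snd (f n) \<ge> 1"
    using \<phi> n bij_betwE[of f "{1..}" "{1..} \<times> {1..}"]
    unfolding computes_bijection_def by (auto simp: mem_Times_iff)
  obtain r where r: "halts \<rho> (Num (fst (f n))) (quote r)"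
    "halts r (rule_input (H (n - 1)) \<rho> (snd (f n))) (Lst (H n))"
    using H n unfolding deduction_def by blast
  obtain r' where "halts \<rho> (Num (fst (f n))) (quote r')" "rule r'"
    using lib pos unfolding library_def by blast
  then have "rule r" using halts_deterministic r(1) by fastforce
  then show thesis using that r pos unfolding rules_of_def by blast
qed

lemma algorithmic_sequence_library: "algorithmic_sequence \<rho>"
  using lib unfolding library_def algorithmic_sequence_def by blast

lemma deduction_extends:
  assumes H: "deduction f \<rho> H" and n: "n \<ge> 1" and st: "list_all statement (H (n - 1))"
  shows "list_all statement (H n)" and "prefix (H (n - 1)) (H n)"
proof -
  obtain r where r: "rule r" "halts r (rule_input (H (n - 1)) \<rho> (snd (f n))) (Lst (H n))"
    "snd (f n) \<ge> 1"
    using deduction_step[OF H n] by blast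
  obtain C where "halts r (rule_input (H (n - 1)) \<rho> (snd (f n))) (Lst C)"
    "list_all statement C" "prefix (H (n - 1)) C"
    using rule_halts[OF r(1) st algorithmic_sequence_library r(3)] by blast
  moreover from this have "C = H n" using halts_deterministic r(2) by fastforce
  ultimately show "list_all statement (H n)" "prefix (H (n - 1)) (H n)" by simp_all
qed

lemma deduction_statements:
  assumes "deduction f \<rho> H" and "list_all statement (H 0)"
  shows "list_all statement (H n)"
proof (induction n)
  case (Suc n)
  then show ?case using deduction_extends(1)[OF assms(1), of "Suc n"] by simp
qed (fact assms(2))

lemma deduction_mono:
  assumes "deduction f \<rho> H" and "list_all statement (H 0)" and "i \<le> j"
  shows "set (H i) \<subseteq> set (H j)"
  using \<open>i \<le> j\<close>
proof (induction j rule: dec_induct)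
  case (step n)
  then show ?case
    using deduction_extends(2)[OF assms(1), of "Suc n"] deduction_statements[OF assms(1,2)]
      set_mono_prefix by fastforce
qed simp

text \<open>Infinitely many pairs \<open>(k, m')\<close> have a large \<open>m'\<close>, and the
  indices up to \<open>j\<close> account for only finitely many of them.\<close>

lemma deduction_late_use:
  assumes "k \<ge> 1"
  shows "\<exists>n>j. fst (f n) = k \<and> snd (f n) \<ge> m"
proof -
  have bij: "bij_betw f {1..} ({1..} \<times> {1..})"
    using \<phi> unfolding computes_bijection_def by blast
  \<comment> \<open>Starting at \<open>Suc m\<close> keeps the second component positive, as the
    range of \<open>f\<close> requires.\<close>
  have "infinite (Pair k ` {Suc m..})"
    by (simp add: finite_image_iff inj_on_def infinite_Ici)
  then have "\<not> Pair k ` {Suc m..} \<subseteq> f ` {1..j}"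
    using finite_subset by blast
  then obtain m' where m': "m' \<ge> Suc m" "(k, m') \<notin> f ` {1..j}" by blast
  moreover have "(k, m') \<in> f ` {1..}"
    using bij_betw_imp_surj_on[OF bij] assms m'(1) by auto
  then obtain n where n: "n \<ge> 1" "f n = (k, m')" by force
  moreover from n m'(2) have "n > j" by (force simp: not_less[symmetric])
  ultimately show ?thesis by (intro exI[of _ n]) simp
qed

text \<open>Each step of \<open>H\<close> is matched by a later use of the same rule in
  \<open>H'\<close>, with at least the same resource and on a list with at least the same items;
  monotonicity of rules does the rest.\<close>

lemma deduction_dominated:
  assumes H: "deduction f \<rho> H" "list_all statement (H 0)"
    and H': "deduction f \<rho> H'" "list_all statement (H' 0)"
    and le: "set (H 0) \<subseteq> set (H' j)"
  shows "\<exists>j. set (H i) \<subseteq> set (H' j)"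
proof (induction i)
  case 0
  show ?case using le by blast
next
  case (Suc i)
  then obtain j where j: "set (H i) \<subseteq> set (H' j)" by blast
  obtain r where r: "rule r" "halts \<rho> (Num (fst (f (Suc i)))) (quote r)"
    "halts r (rule_input (H i) \<rho> (snd (f (Suc i)))) (Lst (H (Suc i)))"
    and pos: "fst (f (Suc i)) \<ge> 1" "snd (f (Suc i)) \<ge> 1"
    using deduction_step[OF H(1), of "Suc i"] by auto
  obtain n where n: "n > j" "fst (f n) = fst (f (Suc i))" "snd (f n) \<ge> snd (f (Suc i))"
    using deduction_late_use[OF pos(1)] by blast
  obtain r' where "halts \<rho> (Num (fst (f n))) (quote r')"
    "halts r' (rule_input (H' (n - 1)) \<rho> (snd (f n))) (Lst (H' n))"
    using deduction_step[OF H'(1), of n] n(1) by auto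
  moreover from this have "r' = r" using r(2) n(2) halts_deterministic by fastforce
  moreover have "set (H i) \<subseteq> set (H' (n - 1))"
    using j deduction_mono[OF H', of j "n - 1"] n(1) by fastforce
  ultimately have "set (H (Suc i)) \<subseteq> set (H' n)"
    using r(1,3) pos(2) n(3) algorithmic_sequence_library
      deduction_statements[OF H] deduction_statements[OF H']
    unfolding rule_def by blast
  then show ?case by blast
qed

lemma deduction_sound:
  assumes valid: "valid_library \<rho>" and H: "deduction f \<rho> H" and "list_all true_statement (H 0)"
  shows "list_all true_statement (H n)"
proof (induction n)
  case (Suc n)
  obtain r where "r \<in> rules_of \<rho>" "halts r (rule_input (H n) \<rho> (snd (f (Suc n)))) (Lst (H (Suc n)))"
    "snd (f (Suc n)) \<ge> 1"
    using deduction_step[OF H, of "Suc n"] by auto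
  then show ?case using valid Suc unfolding valid_library_def rule_valid_def by blast
qed (fact assms(3))

text \<open>From \<open>K\<close> alone the Curry rule produces the negation of \<open>K\<close>,
  and from then on the deduction dominates the one that starts from both.\<close>

lemma negation_curry_statement:
  assumes K: "K = curry_statement \<phi> (quote \<rho>)" and r: "curry_rule \<phi> \<in> rules_of \<rho>"
    and ded: "true_statement (deducible \<phi> [K, negation \<phi> (quote \<rho>) K] (quote \<rho>) \<F>)"
  shows "true_statement (negation \<phi> (quote \<rho>) K)"
proof -
  have st: "list_all statement [K]" "list_all statement [K, negation \<phi> (quote \<rho>) K]"
    using statement_curry_statement statement_negation by (simp_all add: K)
  obtain H where H: "H 0 = [K, negation \<phi> (quote \<rho>) K]" "deduction f \<rho> H"
    using deduction_exists[OF \<phi> lib st(2)] by blast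
  obtain H' where H': "H' 0 = [K]" "deduction f \<rho> H'"
    using deduction_exists[OF \<phi> lib st(1)] by blast
  note mono = deduction_mono[OF H'(2), unfolded H'(1), OF st(1)]
  obtain k where k: "k \<ge> 1" "halts \<rho> (Num k) (quote (curry_rule \<phi>))"
    using r unfolding rules_of_def by blast
  obtain n where n: "n > 0" "fst (f n) = k" using deduction_late_use[OF k(1)] by blast
  obtain s where "halts \<rho> (Num k) (quote s)"
    "halts s (rule_input (H' (n - 1)) \<rho> (snd (f n))) (Lst (H' n))"
    using deduction_step[OF H'(2), of n] n by auto
  moreover from this have "s = curry_rule \<phi>" using k(2) halts_deterministic by fastforce
  moreover have "K \<in> set (H' (n - 1))" using mono[of 0 "n - 1"] H'(1) by simp
  ultimately have "set (H 0) \<subseteq> set (H' n)" by (simp add: halts_curry_rule K H(1))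
  moreover obtain i where "\<F> \<in> set (H i)"
    using ded true_deducible_iff[OF \<phi> H(2,1)] by blast
  ultimately obtain j where "\<F> \<in> set (H' j)"
    using deduction_dominated[OF H(2) _ H'(2), of n i] H(1) H'(1) st by auto
  \<comment> \<open>\<open>deduce\<close> does not search the initial list, so an index of at least
    1 is needed.\<close>
  then have "\<F> \<in> set (H' (Suc j))" using mono[of j "Suc j"] by auto
  then show ?thesis
    unfolding negation_def implication_def using true_deducible_iff[OF \<phi> H'(2,1)] by fastforce
qed

end

section \<open>The contradiction\<close>

lemma not_true_negation:
  assumes \<phi>: "computes_bijection \<phi> f" and valid: "valid_library \<rho>"
    and A: "true_statement A"
  shows "\<not> true_statement (negation \<phi> (quote \<rho>) A)"
proof
  assume neg: "true_statement (negation \<phi> (quote \<rho>) A)"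
  have lib: "library \<rho>" using valid unfolding valid_library_def by blast
  have "statement A" using A unfolding true_statement_def statement_def by blast
  then obtain H where H: "H 0 = [A]" "deduction f \<rho> H"
    using deduction_exists[OF \<phi> lib, of "[A]"] by auto
  obtain i where "\<F> \<in> set (H i)"
    using neg true_deducible_iff[OF \<phi> H(2,1)] unfolding negation_def implication_def by blast
  moreover have "list_all true_statement (H i)"
    using deduction_sound[OF \<phi> lib valid H(2)] H(1) A by simp
  ultimately have "true_statement \<F>" by (auto simp: list_all_iff)
  \<comment> \<open>Folding the quotations back lets \<open>quote_inject\<close> identify the
    algorithm as \<open>Identity\<close>, which maps 0 to 0 and not to 1.\<close>
  then show False by (auto simp: true_statement_def false_statement_def simp flip: quote.simps)
qed

theorem theorem14p2:
  fixes f :: "nat \<Rightarrow> nat \<times> nat" and \<phi> :: alg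
  assumes "computes_bijection \<phi> f"
  shows "\<not> (\<exists>B. base B \<and> stable_base B \<and>
    (\<forall>\<rho>. base_library B \<rho> \<and> valid_library \<rho> \<longrightarrow>
      (\<forall>A. statement A \<longrightarrow>
        true_statement (deducible \<phi> [A, negation \<phi> (quote \<rho>) A] (quote \<rho>) \<F>))))"
proof
  assume "\<exists>B. base B \<and> stable_base B \<and>
    (\<forall>\<rho>. base_library B \<rho> \<and> valid_library \<rho> \<longrightarrow>
      (\<forall>A. statement A \<longrightarrow>
        true_statement (deducible \<phi> [A, negation \<phi> (quote \<rho>) A] (quote \<rho>) \<F>)))"
  then obtain B where B: "base B" "stable_base B"
    and law: "\<And>\<rho> A. base_library B \<rho> \<Longrightarrow> valid_library \<rho> \<Longrightarrow> statement A \<Longrightarrow>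
      true_statement (deducible \<phi> [A, negation \<phi> (quote \<rho>) A] (quote \<rho>) \<F>)"
    by blast
  obtain \<rho> where \<rho>: "library \<rho>" "rules_of \<rho> = insert (curry_rule \<phi>) B"
    using library_insert_base[OF assms B(1) rule_curry_rule] by blast
  then have bl: "base_library B \<rho>" unfolding base_library_def by blast
  \<comment> \<open>Only the Curry rule can lie outside \<open>B\<close>, and it is valid with
    respect to every \<rho>.\<close>
  moreover have "valid_outside B \<rho>"
    using \<rho>(2) rule_valid_curry_rule by (auto simp: valid_outside_def)
  ultimately have valid: "valid_library \<rho>" using B(2) unfolding stable_base_def by blast
  let ?K = "curry_statement \<phi> (quote \<rho>)"
  have "true_statement (negation \<phi> (quote \<rho>) ?K)"
    using negation_curry_statement[OF assms \<rho>(1) refl]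
      law[OF bl valid statement_curry_statement] \<rho>(2) by blast
  then show False
    using not_true_negation[OF assms valid] true_curry_statement_iff by blast
qed

end
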